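(* Let $\mathcal{T}=(Q,A,B^*,E,i,T)$ be a real-time transducer with $n$ states and such that the lengths of the outputs of its transitions are bounded by $L$. If $\mathcal{T}$ is $k$-valued, then for every $N\ge L\,n^{k+1}$ the transducer $\mathcal{V}_N$ (built from $\mathcal{T}$ as in the context) is input-$k$-ambiguous.
   Context: Transducers. $A,B$ are finite alphabets. A real-time transducer $\mathcal{T}=(Q,A,B^*,E,i,T)$ has a finite set $Q$ of states, an initial state $i$, a set $T\subseteq Q$ of final states, and a finite set $E$ of transitions, each associated with a triple $(p,\,a|x,\,q)$, $p,q\in Q$, $a\in A$ (input), $x\in B^*$ (output), written $p\xrightarrow{a|x}q$; distinct transitions may carry the same triple. A computation is a path; its input and output are the concatenations of the inputs and outputs of its transitions. It is successful if it starts in $i$ and ends in $T$. $\mathcal{T}$ is $k$-valued if every $u\in A^*$ is the input of successful computations having in total at most $k$ distinct outputs. A transducer is input-$k$-ambiguous if every $u\in A^*$ is the input of at most $k$ successful computations. Ordering. Fix a partial order $\prec$ on $E$ such that two transitions are comparable iff they have the same origin and the same input letter. Extend it lexicographically to computations: $c=e_1\cdots e_m\prec d=e'_1\cdots e'_m$ iff $c,d$ have the same input and there is $l$ with $e_j=e'_j$ for $j<l$ and $e_l\prec e'_l$. Words and differences. $F(B)$ is the free group on $B$, with identity $\mathbf{1}$; $\bar{B}$ is a copy of $B$ representing the inverses of the letters, and $\bar{x}$ is the inverse of $x\in B^*$. Put $\Delta_N=B^{\le N}\cup\bar{B}^{\le N}\subseteq F(B)$, where $B^{\le N}$ is the set of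 words of length at most $N$. For a set $Z\subseteq F(B)$ put $Z\rho_N=Z\cap\Delta_N$; $\rho_N$ is applied componentwise to vectors of subsets. The transducer $\mathcal{U}_N$. Its states are the pairs $(p,\mathsf{v})$ with $p\in Q$ and $\mathsf{v}\in\mathfrak{P}(\Delta_N)^Q$ ($\mathfrak{P}$ denotes powerset); its initial state is $(i,\vec{0})$, where $\vec{0}$ has all entries $\emptyset$; its final states are the $(p,\mathsf{v})$ with $p\in T$. For every state $(p,\mathsf{v})$ and every transition $e:p\xrightarrow{a|x}q$ in $E$ there is exactly one transition $(p,\mathsf{v})\xrightarrow{a|x}(q,\mathsf{w})$, where for each $r\in Q$, $$\mathsf{w}_r=\Bigl(\{\bar{x}wy : q'\in Q,\ w\in\mathsf{v}_{q'},\ q'\xrightarrow{a|y}r \text{ in }E\}\ \cup\ \{\bar{x}y : f:p\xrightarrow{a|y}r \text{ in }E,\ f\prec e\}\Bigr)\rho_N .$$ These are all the transitions of $\mathcal{U}_N$. The transducer $\mathcal{V}_N$ is obtained from $\mathcal{U}_N$ by making non-final every state $(p,\mathsf{v})$, $p\in T$, such that $\mathbf{1}\in\mathsf{v}_t$ for some $t\in T$. *)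

theory Defs
  imports "HOL-Algebra.Group"
begin

subsection \<open>The free group\<close>

datatype 'b letter = Pos (base: 'b) | Neg (base: 'b)

fun bar :: "'b letter \<Rightarrow> 'b letter" where
  "bar (Pos b) = Neg b"
| "bar (Neg b) = Pos b"

definition reduced :: "'b letter list \<Rightarrow> bool" where
  "reduced w \<longleftrightarrow> successively (\<lambda>x y. y \<noteq> bar x) w"

text \<open>Multiplication of a reduced word by a letter on the left, and of two reduced words.\<close>

fun lcons :: "'b letter \<Rightarrow> 'b letter list \<Rightarrow> 'b letter list" where
  "lcons x [] = [x]"
| "lcons x (y # w) = (if y = bar x then w else x # y # w)"

definition fmult :: "'b letter list \<Rightarrow> 'b letter list \<Rightarrow> 'b letter list" where
  "fmult u v = foldr lcons u v"

text \<open>The free group on \<open>B\<close>, realised on the reduced words over the letters of \<open>B\<close> and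
  their formal inverses.\<close>

definition free_group :: "'b set \<Rightarrow> 'b letter list monoid" where
  "free_group B =
     \<lparr>carrier = {w. reduced w \<and> base ` set w \<subseteq> B}, mult = fmult, one = []\<rparr>"

text \<open>The inclusion of the free monoid into the free group.\<close>

definition word :: "'b list \<Rightarrow> 'b letter list" where
  "word x = map Pos x"

lemma bar_bar [simp]: "bar (bar x) = x"
  by (cases x) auto

lemma base_bar [simp]: "base (bar x) = base x"
  by (cases x) auto

lemma bar_eq_iff [simp]: "bar x = bar y \<longleftrightarrow> x = y"
  by (metis bar_bar)

lemma reduced_simps [simp]:
  "reduced []" "reduced [x]"
  "reduced (x # y # w) \<longleftrightarrow> y \<noteq> bar x \<and> reduced (y # w)"
  by (auto simp: reduced_def)

lemma reduced_tl: "reduced (x # w) \<Longrightarrow> reduced w"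
  by (cases w) auto

lemma reduced_lcons: "reduced w \<Longrightarrow> reduced (lcons x w)"
  by (cases w) (auto dest: reduced_tl)

lemma reduced_foldr_lcons: "reduced v \<Longrightarrow> reduced (foldr lcons u v)"
  by (induction u) (auto intro: reduced_lcons)

lemma set_lcons: "set (lcons x w) \<subseteq> insert x (set w)"
  by (cases w) auto

lemma set_foldr_lcons: "set (foldr lcons u v) \<subseteq> set u \<union> set v"
proof (induction u)
  case (Cons a u)
  then show ?case using set_lcons[of a "foldr lcons u v"] by auto
qed simp

lemma lcons_lcons_bar: "reduced w \<Longrightarrow> lcons x (lcons (bar x) w) = w"
proof (cases w)
  case (Cons y w')
  assume "reduced w"
  with Cons show ?thesis by (cases w') auto
qed simp

lemma foldr_lcons_lcons:
  assumes "reduced t" "reduced w"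
  shows "foldr lcons (lcons x t) w = lcons x (foldr lcons t w)"
  using assms by (cases t) (auto simp: lcons_lcons_bar reduced_foldr_lcons)

lemma fmult_assoc:
  assumes "reduced v" "reduced w"
  shows "fmult (fmult u v) w = fmult u (fmult v w)"
  unfolding fmult_def using assms
  by (induction u) (auto simp: foldr_lcons_lcons reduced_foldr_lcons)

lemma fmult_Nil_right: "reduced u \<Longrightarrow> fmult u [] = u"
proof (induction u)
  case (Cons a u)
  then have "fmult u [] = u" by (blast dest: reduced_tl)
  with Cons.prems show ?case by (cases u) (auto simp: fmult_def)
qed (simp add: fmult_def)

lemma foldr_lcons_inverse:
  "reduced v \<Longrightarrow> foldr lcons (rev (map bar u)) (foldr lcons u v) = v"
proof (induction u arbitrary: v)
  case (Cons a u)
  have "lcons (bar a) (lcons a (foldr lcons u v)) = foldr lcons u v"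
    using lcons_lcons_bar[of "foldr lcons u v" "bar a"] Cons.prems
    by (simp add: reduced_foldr_lcons)
  with Cons show ?case by simp
qed simp

lemma reduced_rev_map_bar: "reduced u \<Longrightarrow> reduced (rev (map bar u))"
  unfolding reduced_def successively_rev successively_map
  by (erule successively_mono) auto

lemma fmult_inverse: "reduced u \<Longrightarrow> fmult (rev (map bar u)) u = []"
  using foldr_lcons_inverse[of "[]" u] fmult_Nil_right[of u] by (simp add: fmult_def)

theorem group_free_group: "group (free_group B)"
proof (rule groupI)
  fix u v assume "u \<in> carrier (free_group B)" "v \<in> carrier (free_group B)"
  then show "u \<otimes>\<^bsub>free_group B\<^esub> v \<in> carrier (free_group B)"
    using set_foldr_lcons[of u v]
    by (fastforce simp: free_group_def fmult_def reduced_foldr_lcons)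
next
  fix u assume u: "u \<in> carrier (free_group B)"
  then have "rev (map bar u) \<in> carrier (free_group B)"
    by (auto simp: free_group_def reduced_rev_map_bar)
  moreover have "rev (map bar u) \<otimes>\<^bsub>free_group B\<^esub> u = \<one>\<^bsub>free_group B\<^esub>"
    using u by (simp add: free_group_def fmult_inverse)
  ultimately show "\<exists>v\<in>carrier (free_group B). v \<otimes>\<^bsub>free_group B\<^esub> u = \<one>\<^bsub>free_group B\<^esub>"
    by blast
qed (auto simp: free_group_def fmult_assoc, simp add: fmult_def)

lemma inv_free_group:
  assumes "u \<in> carrier (free_group B)"
  shows "inv\<^bsub>free_group B\<^esub> u = rev (map bar u)"
proof -
  interpret group "free_group B" by (rule group_free_group)
  show ?thesis
    using assms by (intro inv_equality)
      (auto simp: free_group_def fmult_inverse reduced_rev_map_bar)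
qed

lemma word_closed: "x \<in> lists B \<Longrightarrow> word x \<in> carrier (free_group B)"
  by (auto simp: free_group_def word_def reduced_def successively_map successively_conv_nth)

lemma word_append: "word (x @ y) = word x \<otimes>\<^bsub>free_group B\<^esub> word y"
proof -
  have *: "lcons (Pos b) (word z) = word (b # z)" for b :: 'a and z
    by (cases z) (auto simp: word_def)
  have "foldr lcons (word x) (word y) = word (x @ y)"
  proof (induction x)
    case (Cons b x)
    have "foldr lcons (word (b # x)) (word y) = lcons (Pos b) (foldr lcons (word x) (word y))"
      by (simp add: word_def)
    with Cons show ?case by (simp add: *)
  qed (simp add: word_def)
  then show ?thesis by (simp add: free_group_def fmult_def)
qed

definition Delta :: "'b set \<Rightarrow> nat \<Rightarrow> 'b letter list set" where
  "Delta B N = {word x | x. x \<in> lists B \<and> length x \<le> N}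
     \<union> {inv\<^bsub>free_group B\<^esub> (word x) | x. x \<in> lists B \<and> length x \<le> N}"

lemma finite_Delta: "finite B \<Longrightarrow> finite (Delta B N)"
proof -
  assume "finite B"
  then have "finite {x. x \<in> lists B \<and> length x \<le> N}"
    using finite_lists_length_le[of B N] by (simp add: lists_eq_set)
  then show ?thesis
    unfolding Delta_def by simp
qed

subsection \<open>Real-time transducers\<close>

text \<open>Transitions are abstract elements of type \<open>'e\<close>, so that distinct transitions may carry
  the same triple.\<close>

record ('q, 'a, 'b, 'e) transducer =
  states :: "'q set"
  transitions :: "'e set"
  origin :: "'e \<Rightarrow> 'q"
  letter_in :: "'e \<Rightarrow> 'a"
  word_out :: "'e \<Rightarrow> 'b list"
  target :: "'e \<Rightarrow> 'q"
  initial :: 'q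
  final :: "'q set"

locale real_time_transducer =
  fixes A :: "'a set" and B :: "'b set" and T :: "('q, 'a, 'b, 'e) transducer"
  assumes finite_input_alphabet: "finite A"
    and finite_output_alphabet: "finite B"
    and finite_states: "finite (states T)"
    and finite_transitions: "finite (transitions T)"
    and initial_state: "initial T \<in> states T"
    and final_states: "final T \<subseteq> states T"
    and origin_state: "e \<in> transitions T \<Longrightarrow> origin T e \<in> states T"
    and target_state: "e \<in> transitions T \<Longrightarrow> target T e \<in> states T"
    and letter_in_alphabet: "e \<in> transitions T \<Longrightarrow> letter_in T e \<in> A"
    and word_out_alphabet: "e \<in> transitions T \<Longrightarrow> word_out T e \<in> lists B"

fun is_path :: "('q, 'a, 'b, 'e) transducer \<Rightarrow> 'q \<Rightarrow> 'e list \<Rightarrow> 'q \<Rightarrow> bool" where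
  "is_path T p [] q \<longleftrightarrow> p \<in> states T \<and> p = q"
| "is_path T p (e # c) q \<longleftrightarrow> e \<in> transitions T \<and> origin T e = p \<and> is_path T (target T e) c q"

definition input_of :: "('q, 'a, 'b, 'e) transducer \<Rightarrow> 'e list \<Rightarrow> 'a list" where
  "input_of T c = map (letter_in T) c"

definition output_of :: "('q, 'a, 'b, 'e) transducer \<Rightarrow> 'e list \<Rightarrow> 'b list" where
  "output_of T c = concat (map (word_out T) c)"

text \<open>All successful computations start in the initial state, so each of them is determined by
  its list of transitions, including the empty one.\<close>

definition successful :: "('q, 'a, 'b, 'e) transducer \<Rightarrow> 'e list set" where
  "successful T = {c. \<exists>t\<in>final T. is_path T (initial T) c t}"

definition valued :: "nat \<Rightarrow> 'a set \<Rightarrow> ('q, 'a, 'b, 'e) transducer \<Rightarrow> bool" where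
  "valued k A T \<longleftrightarrow> (\<forall>u\<in>lists A.
     finite (output_of T ` {c \<in> successful T. input_of T c = u}) \<and>
     card (output_of T ` {c \<in> successful T. input_of T c = u}) \<le> k)"

definition input_ambiguous :: "nat \<Rightarrow> 'a set \<Rightarrow> ('q, 'a, 'b, 'e) transducer \<Rightarrow> bool" where
  "input_ambiguous k A T \<longleftrightarrow> (\<forall>u\<in>lists A.
     finite {c \<in> successful T. input_of T c = u} \<and>
     card {c \<in> successful T. input_of T c = u} \<le> k)"

text \<open>The order is strict; comparability of distinct transitions is therefore required
  separately.\<close>

definition transition_order ::
    "('q, 'a, 'b, 'e) transducer \<Rightarrow> ('e \<Rightarrow> 'e \<Rightarrow> bool) \<Rightarrow> bool" where
  "transition_order T prec \<longleftrightarrow>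
     irreflp_on (transitions T) prec \<and> transp_on (transitions T) prec \<and>
     (\<forall>e\<in>transitions T. \<forall>f\<in>transitions T. e \<noteq> f \<longrightarrow>
        (prec e f \<or> prec f e \<longleftrightarrow> origin T e = origin T f \<and> letter_in T e = letter_in T f))"

subsection \<open>The transducers \<open>U\<^sub>N\<close> and \<open>V\<^sub>N\<close>\<close>

text \<open>Vectors indexed by the states are extensional functions. Along a path of \<open>U\<^sub>N\<close> that
  starts in the initial state, the component of index \<open>r\<close> contains the elements \<open>x\<inverse> y\<close>, where \<open>x\<close> is
  the output of the path and \<open>y\<close> that of a lexicographically smaller computation of \<open>T\<close> with the
  same input, ending in \<open>r\<close>, provided that these differences stay in \<open>Delta B N\<close> throughout.\<close>

type_synonym ('q, 'b) vec = "'q \<Rightarrow> 'b letter list set"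

definition next_vec ::
    "'b set \<Rightarrow> ('q, 'a, 'b, 'e) transducer \<Rightarrow> ('e \<Rightarrow> 'e \<Rightarrow> bool) \<Rightarrow> nat \<Rightarrow>
     ('q, 'b) vec \<Rightarrow> 'e \<Rightarrow> ('q, 'b) vec" where
  "next_vec B T prec N v e = (\<lambda>r\<in>states T.
     ({inv\<^bsub>free_group B\<^esub> (word (word_out T e)) \<otimes>\<^bsub>free_group B\<^esub> w
          \<otimes>\<^bsub>free_group B\<^esub> word (word_out T g) | w g.
         g \<in> transitions T \<and> w \<in> v (origin T g) \<and>
         letter_in T g = letter_in T e \<and> target T g = r}
      \<union> {inv\<^bsub>free_group B\<^esub> (word (word_out T e)) \<otimes>\<^bsub>free_group B\<^esub> word (word_out T f) | f.
         f \<in> transitions T \<and> origin T f = origin T e \<and>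
         letter_in T f = letter_in T e \<and> target T f = r \<and> prec f e})
     \<inter> Delta B N)"

text \<open>The transitions of \<open>U\<^sub>N\<close> are the pairs of a state \<open>(p, v)\<close> and a transition of \<open>T\<close> with
  origin \<open>p\<close>.\<close>

definition U_trans ::
    "'b set \<Rightarrow> ('q, 'a, 'b, 'e) transducer \<Rightarrow> ('e \<Rightarrow> 'e \<Rightarrow> bool) \<Rightarrow> nat \<Rightarrow>
     ('q \<times> ('q, 'b) vec, 'a, 'b, ('q \<times> ('q, 'b) vec) \<times> 'e) transducer" where
  "U_trans B T prec N =
     \<lparr>states = states T \<times> (states T \<rightarrow>\<^sub>E Pow (Delta B N)),
      transitions = {((p, v), e). p \<in> states T \<and> v \<in> states T \<rightarrow>\<^sub>E Pow (Delta B N) \<and>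
                       e \<in> transitions T \<and> origin T e = p},
      origin = fst,
      letter_in = (\<lambda>(s, e). letter_in T e),
      word_out = (\<lambda>(s, e). word_out T e),
      target = (\<lambda>((p, v), e). (target T e, next_vec B T prec N v e)),
      initial = (initial T, \<lambda>r\<in>states T. {}),
      final = final T \<times> (states T \<rightarrow>\<^sub>E Pow (Delta B N))\<rparr>"

definition V_trans ::
    "'b set \<Rightarrow> ('q, 'a, 'b, 'e) transducer \<Rightarrow> ('e \<Rightarrow> 'e \<Rightarrow> bool) \<Rightarrow> nat \<Rightarrow>
     ('q \<times> ('q, 'b) vec, 'a, 'b, ('q \<times> ('q, 'b) vec) \<times> 'e) transducer" where
  "V_trans B T prec N = (U_trans B T prec N)
     \<lparr>final := {(p, v) \<in> final (U_trans B T prec N).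
                  \<not> (\<exists>t\<in>final T. \<one>\<^bsub>free_group B\<^esub> \<in> v t)}\<rparr>"

lemma next_vec_in: "next_vec B T prec N v e \<in> states T \<rightarrow>\<^sub>E Pow (Delta B N)"
  by (auto simp: next_vec_def)

context real_time_transducer
begin

lemma real_time_transducer_U: "real_time_transducer A B (U_trans B T prec N)"
proof
  have fin: "finite (states T \<rightarrow>\<^sub>E Pow (Delta B N))"
    by (intro finite_PiE finite_states) (simp add: finite_Delta finite_output_alphabet)
  then show "finite (states (U_trans B T prec N))"
    by (simp add: U_trans_def finite_states)
  have "transitions (U_trans B T prec N)
          \<subseteq> (states T \<times> (states T \<rightarrow>\<^sub>E Pow (Delta B N))) \<times> transitions T"
    by (auto simp: U_trans_def)
  then show "finite (transitions (U_trans B T prec N))"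
    by (rule finite_subset) (intro finite_cartesian_product fin finite_states finite_transitions)
next
  fix e assume e: "e \<in> transitions (U_trans B T prec N)"
  then show "target (U_trans B T prec N) e \<in> states (U_trans B T prec N)"
    by (cases e) (simp add: U_trans_def target_state next_vec_in split: prod.splits)
  from e show "word_out (U_trans B T prec N) e \<in> lists B"
    using word_out_alphabet by (auto simp: U_trans_def simp del: in_lists_conv_set)
qed (use initial_state final_states letter_in_alphabet in
     \<open>auto simp: U_trans_def finite_input_alphabet finite_output_alphabet\<close>)

lemma real_time_transducer_V: "real_time_transducer A B (V_trans B T prec N)"
proof -
  interpret U: real_time_transducer A B "U_trans B T prec N"
    by (rule real_time_transducer_U)
  show ?thesis
    by unfold_locales
      (use U.finite_states U.finite_transitions U.initial_state U.final_states U.origin_state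
        U.target_state U.letter_in_alphabet U.word_out_alphabet in
        \<open>auto simp: V_trans_def finite_input_alphabet finite_output_alphabet\<close>)
qed

end

end

theory Submission imports Defs begin

text \<open>Distinct successful computations of \<open>V\<^sub>N\<close> on the same input project to distinct computations of
  \<open>T\<close>, and two of these with equal outputs must, at some moment, have produced outputs whose
  lengths differ by more than \<open>N\<close>: otherwise the larger one would have ended in a state that is
  not final in \<open>V\<^sub>N\<close>. Given \<open>k + 1\<close> such computations, regarded as one path of the
  \<open>(k + 1)\<close>-fold product of \<open>T\<close>, a lag above \<open>L n\<^sup>k\<^sup>+\<^sup>1\<close> yields a loop in the product on which the two
  computations produce outputs of different lengths. Pumping this loop often enough separates
  the two outputs, keeps outputs apart that were distinct before, and preserves the large lags of
  the remaining pairs. After finitely many such steps all \<open>k + 1\<close> outputs are distinct, so \<open>T\<close> is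
  not \<open>k\<close>-valued.\<close>

subsection \<open>Pumping words\<close>

abbreviation word_pow :: "nat \<Rightarrow> 'a list \<Rightarrow> 'a list" where
  "word_pow m w \<equiv> concat (replicate m w)"

lemma length_word_pow [simp]: "length (word_pow m w) = m * length w"
  by (induction m) auto

lemma word_pow_conjugate:
  assumes "y @ s = s @ y'"
  shows "word_pow m y @ s = s @ word_pow m y'"
proof (induction m)
  case (Suc m)
  then have "word_pow (Suc m) y @ s = (y @ s) @ word_pow m y'" by simp
  with assms show ?case by simp
qed simp

lemma word_pow_Suc_right: "word_pow (Suc m) w = word_pow m w @ w"
  by (induction m) auto

text \<open>The power is long enough for the shift \<open>s\<close> to be absorbed by the period, so that
  \<open>y\<close> and \<open>y'\<close> are conjugate by \<open>s\<close>.\<close>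

lemma pumped_eq_imp_eq_shift:
  assumes len: "length y = length y'" and m: "length s < m"
    and eq: "word_pow m y @ z = s @ word_pow m y' @ z'"
  shows "y @ z = s @ y' @ z'"
proof (cases "y = []")
  case True
  with len eq show ?thesis by simp
next
  case False
  obtain m' where m': "m = Suc m'" "length s \<le> m'" using m by (cases m) auto
  have "m' \<le> m' * length y" using False by (cases y) auto
  then have le: "length s \<le> m' * length y" using m'(2) by linarith
  have s: "take (length s) (word_pow m' y) = s"
  proof -
    have "take (length s) (word_pow m y @ z) = s" by (simp add: eq)
    then show ?thesis using le unfolding m'(1) word_pow_Suc_right by simp
  qed
  \<comment> \<open>Both sides of the equation are cut at length \<open>length y + length s\<close>:
    on the left \<open>y\<close> is followed by the start of the remaining \<open>m'\<close> copies,
    which is \<open>s\<close>; on the right \<open>s\<close> is followed by the first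
    \<open>y'\<close>.\<close>
  have "y @ s = take (length y + length s) (word_pow m y @ z)"
    using le by (simp add: m'(1) s)
  also have "\<dots> = s @ y'" unfolding eq by (simp add: m'(1) len)
  finally have conj: "y @ s = s @ y'" .
  have "word_pow m y @ z = word_pow m y @ s @ z'"
    using eq word_pow_conjugate[OF conj, of m] by (metis append.assoc)
  then have "z = s @ z'" by simp
  with conj show ?thesis by (metis append.assoc)
qed

text \<open>One of \<open>x\<close>, \<open>x'\<close> is a prefix of the other; the excess is a
  shift shorter than \<open>m\<close>.\<close>

lemma pumped_eq_imp_eq:
  assumes "length y = length y'" "length x + length x' < m"
    and eq: "x @ word_pow m y @ z = x' @ word_pow m y' @ z'"
  shows "x @ y @ z = x' @ y' @ z'"
proof -
  from eq consider s where "x = x' @ s" "s @ word_pow m y @ z = word_pow m y' @ z'"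
    | s where "x' = x @ s" "word_pow m y @ z = s @ word_pow m y' @ z'"
    unfolding append_eq_append_conv2[of x] by metis
  then show ?thesis
  proof cases
    case 1
    with assms(1,2) pumped_eq_imp_eq_shift[of y' y s m z' z] show ?thesis by simp
  next
    case 2
    with assms(1,2) pumped_eq_imp_eq_shift[of y y' s m z z'] show ?thesis by simp
  qed
qed

section \<open>Pumping with large exponents\<close>

lemma eventually_length_neq:
  assumes "(p::nat) \<noteq> p'"
  shows "eventually (\<lambda>m. b + m * p \<noteq> b' + m * p') sequentially"
proof (rule eventually_sequentiallyI)
  fix m assume m: "b + b' + 1 \<le> m"
  show "b + m * p \<noteq> b' + m * p'"
  proof (cases "p < p'")
    case True
    then have "m * (p + 1) \<le> m * p'" by (intro mult_le_mono2) simp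
    with m show ?thesis by simp
  next
    case False
    with assms have "m * (p' + 1) \<le> m * p" by (intro mult_le_mono2) simp
    with m show ?thesis by simp
  qed
qed

text \<open>For loops of equal length, equality at a large exponent would pull back to exponent 1;
  otherwise the lengths drift apart. Stating it with \<open>eventually\<close> allows one exponent
  to serve finitely many pairs.\<close>

lemma eventually_pumped_neq:
  assumes "x @ y @ z \<noteq> x' @ y' @ z'"
  shows "eventually (\<lambda>m. x @ word_pow m y @ z \<noteq> x' @ word_pow m y' @ z') sequentially"
proof (cases "length y = length y'")
  case True
  show ?thesis
  proof (rule eventually_sequentiallyI)
    fix m assume "length x + length x' + 1 \<le> m"
    then show "x @ word_pow m y @ z \<noteq> x' @ word_pow m y' @ z'"
      using assms pumped_eq_imp_eq[OF True, of x x' m z z'] by linarith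
  qed
next
  case False
  have "eventually (\<lambda>m. length x + length z + m * length y
      \<noteq> length x' + length z' + m * length y') sequentially"
    by (rule eventually_length_neq[OF False])
  then show ?thesis
  proof (rule eventually_mono)
    fix m assume "length x + length z + m * length y \<noteq> length x' + length z' + m * length y'"
    then have "length (x @ word_pow m y @ z) \<noteq> length (x' @ word_pow m y' @ z')" by simp
    then show "x @ word_pow m y @ z \<noteq> x' @ word_pow m y' @ z'" by metis
  qed
qed

text \<open>To exceed \<open>L * M\<close> with steps of at most \<open>L\<close>, the sequence must
  visit \<open>M + 1\<close> levels of width \<open>L\<close>. With at most \<open>M\<close> values
  of \<open>\<sigma>\<close>, two different levels share one.\<close>

lemma exists_loop_with_drift:
  fixes d :: "nat \<Rightarrow> int" and L M :: nat
  assumes step: "\<And>s. \<bar>d (Suc s) - d s\<bar> \<le> int L" and "d 0 = 0"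
    and big: "int (L * M) < \<bar>d t\<bar>"
    and fin: "finite S" and card: "card S \<le> M" and S: "\<And>s. \<sigma> s \<in> S"
  shows "\<exists>a b. a < b \<and> \<sigma> a = \<sigma> b \<and> d a \<noteq> d b"
proof (rule ccontr)
  assume "\<nexists>a b. a < b \<and> \<sigma> a = \<sigma> b \<and> d a \<noteq> d b"
  then have same: "\<sigma> a = \<sigma> b \<Longrightarrow> d a = d b" for a b
    by (metis linorder_neqE_nat)
  have "L \<noteq> 0"
  proof
    assume "L = 0"
    then have "d s = 0" for s using step \<open>d 0 = 0\<close> by (induction s) auto
    with big \<open>L = 0\<close> show False by simp
  qed
  \<comment> \<open>The level of \<open>d s\<close>. It changes by at most 1 per step, so the
    discrete intermediate value theorem yields every level from 0 to \<open>M\<close>.\<close>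
  define f where "f s = \<bar>d s\<bar> div int L" for s
  have f_step: "\<bar>f (Suc s) - f s\<bar> \<le> 1" for s
  proof -
    have "\<bar>d (Suc s)\<bar> \<le> \<bar>d s\<bar> + int L" "\<bar>d s\<bar> \<le> \<bar>d (Suc s)\<bar> + int L"
      using step[of s] by linarith+
    then have "\<bar>d (Suc s)\<bar> div int L \<le> (\<bar>d s\<bar> + int L) div int L"
      "\<bar>d s\<bar> div int L \<le> (\<bar>d (Suc s)\<bar> + int L) div int L"
      using \<open>L \<noteq> 0\<close> by (auto intro!: zdiv_mono1)
    moreover have "(x + int L) div int L = x div int L + 1" for x
      using \<open>L \<noteq> 0\<close> by (simp add: div_add_self2)
    ultimately show ?thesis unfolding f_def by (simp add: abs_le_iff)
  qed
  have "f 0 = 0" by (simp add: f_def \<open>d 0 = 0\<close>)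
  have "int M \<le> f t"
  proof -
    have "int M = (int L * int M) div int L" using \<open>L \<noteq> 0\<close> by simp
    also have "\<dots> \<le> f t"
      unfolding f_def using big \<open>L \<noteq> 0\<close> by (intro zdiv_mono1) auto
    finally show ?thesis .
  qed
  have "\<exists>s. f s = int j" if "j \<le> M" for j
    using nat0_intermed_int_val[of t f "int j"] f_step \<open>f 0 = 0\<close> \<open>int M \<le> f t\<close> that by auto
  then obtain s where s: "\<And>j. j \<le> M \<Longrightarrow> f (s j) = int j" by metis
  \<comment> \<open>Equal values of \<open>\<sigma>\<close> force equal values of \<open>d\<close>,
    hence equal levels.\<close>
  have "inj_on (\<lambda>j. \<sigma> (s j)) {..M}"
    by (rule inj_onI) (metis atMost_iff f_def of_nat_eq_iff s same)
  then have "card {..M} \<le> card S"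
    by (rule card_inj_on_le) (use S fin in auto)
  with card show False by simp
qed

subsection \<open>Paths and outputs\<close>

lemma is_path_target: "is_path T p c q \<Longrightarrow> q \<in> states T"
  by (induction c arbitrary: p) auto

lemma is_path_transitions: "is_path T p c q \<Longrightarrow> set c \<subseteq> transitions T"
  by (induction c arbitrary: p) auto

lemma is_path_unique_target: "is_path T p c q \<Longrightarrow> is_path T p c r \<Longrightarrow> q = r"
  by (induction c arbitrary: p) auto

lemma output_of_append [simp]: "output_of T (c @ d) = output_of T c @ output_of T d"
  by (simp add: output_of_def)

lemma output_of_Nil [simp]: "output_of T [] = []"
  by (simp add: output_of_def)

lemma output_of_Cons: "output_of T (e # c) = word_out T e @ output_of T c"
  by (simp add: output_of_def)

lemma output_of_word_pow [simp]: "output_of T (word_pow m c) = word_pow m (output_of T c)"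
  by (induction m) auto

section \<open>Pumping a segment of a computation\<close>

definition pump :: "nat \<Rightarrow> nat \<Rightarrow> nat \<Rightarrow> 'e list \<Rightarrow> 'e list" where
  "pump a b m c = take a c @ word_pow m (take (b - a) (drop a c)) @ drop b c"

lemma split_loop: "a \<le> b \<Longrightarrow> c = take a c @ take (b - a) (drop a c) @ drop b c"
  by (metis append.assoc append_take_drop_id le_add_diff_inverse take_add)

lemma take_loop: "a \<le> b \<Longrightarrow> take b c = take a c @ take (b - a) (drop a c)"
  by (metis le_add_diff_inverse take_add)

text \<open>Pumping works by positions only, so computations with a common input still have a common
  input afterwards.\<close>

lemma input_of_pump: "input_of T (pump a b m c) = pump a b m (input_of T c)"
  unfolding pump_def by (simp add: input_of_def map_concat take_map drop_map)

lemma output_of_pump: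
  "output_of T (pump a b m c) = output_of T (take a c)
     @ word_pow m (output_of T (take (b - a) (drop a c))) @ output_of T (drop b c)"
  by (simp add: pump_def)

context real_time_transducer
begin

lemma path_append: "is_path T p (c @ d) q \<longleftrightarrow> (\<exists>r. is_path T p c r \<and> is_path T r d q)"
proof (induction c arbitrary: p)
  case Nil
  have "p \<in> states T" if "is_path T p d q" using that by (cases d) (auto intro: origin_state)
  then show ?case by auto
qed auto

lemma path_word_pow: "is_path T r c r \<Longrightarrow> is_path T r (word_pow m c) r"
  by (induction m) (auto simp: path_append dest: is_path_target)

lemma input_of_successful: "c \<in> successful T \<Longrightarrow> input_of T c \<in> lists A"
  by (auto simp: successful_def input_of_def dest!: is_path_transitions letter_in_alphabet)

lemma output_of_path: "is_path T p c q \<Longrightarrow> output_of T c \<in> lists B"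
  by (induction c arbitrary: p) (auto simp: output_of_Cons word_out_alphabet simp del: in_lists_conv_set)

lemma path_take: "is_path T p c q \<Longrightarrow> \<exists>r. is_path T p (take s c) r"
  using path_append[of p "take s c" "drop s c" q] by auto

lemma path_pump:
  assumes c: "is_path T p c q" and "a \<le> b"
    and loop: "is_path T p (take a c) r" "is_path T p (take b c) r"
  shows "is_path T p (pump a b m c) q"
proof -
  have "is_path T r (take (b - a) (drop a c)) r"
    using loop(2) path_append[of p "take a c" "take (b - a) (drop a c)" r]
      is_path_unique_target[OF loop(1)] unfolding take_loop[OF \<open>a \<le> b\<close>] by blast
  moreover have "is_path T r (drop b c) q"
    using c path_append[of p "take b c" "drop b c" q] is_path_unique_target[OF loop(2)]
    by (metis append_take_drop_id)
  ultimately have "is_path T r (word_pow m (take (b - a) (drop a c)) @ drop b c) q"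
    using path_word_pow path_append by blast
  with loop(1) show ?thesis
    unfolding pump_def using path_append by blast
qed

subsection \<open>Separating the outputs of a family of computations\<close>

text \<open>Past the end of both computations \<open>take\<close> is constant, so the lag keeps its
  final value and every \<open>s\<close> is a legitimate moment.\<close>

definition lag :: "'e list \<Rightarrow> 'e list \<Rightarrow> nat \<Rightarrow> int" where
  "lag c d s = int (length (output_of T (take s c))) - int (length (output_of T (take s d)))"

lemma lag_0: "lag c d 0 = 0"
  by (simp add: lag_def)

lemma lag_step:
  assumes L: "\<forall>e\<in>transitions T. length (word_out T e) \<le> L"
    and "set c \<subseteq> transitions T" "set d \<subseteq> transitions T"
  shows "\<bar>lag c d (Suc s) - lag c d s\<bar> \<le> int L"
proof -
  \<comment> \<open>Both outputs grow by an amount between 0 and \<open>L\<close>, so their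
    difference changes by at most \<open>L\<close>, not \<open>2 * L\<close>.\<close>
  have *: "\<exists>l\<le>L. length (output_of T (take (Suc s) h)) = length (output_of T (take s h)) + l"
    if "set h \<subseteq> transitions T" for h
  proof (cases "s < length h")
    case True
    then have "h ! s \<in> transitions T" using that by auto
    with True L show ?thesis by (auto simp: take_Suc_conv_app_nth output_of_Cons)
  qed simp
  from *[OF assms(2)] *[OF assms(3)] show ?thesis by (auto simp: lag_def)
qed

text \<open>Up to \<open>b\<close> nothing changes, since at least one copy of the loop remains.
  After \<open>b\<close> the same moment occurs at a shifted position, and both outputs have changed
  by the same length.\<close>

lemma lag_pump:
  assumes len: "length c = length d" and "a \<le> b" "1 \<le> m"
    and same: "length (output_of T (take (b - a) (drop a c)))
      = length (output_of T (take (b - a) (drop a d)))"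
  shows "\<exists>s'. lag (pump a b m c) (pump a b m d) s' = lag c d s"
proof (cases "s \<le> b")
  case True
  obtain m' where m': "m = Suc m'" using \<open>1 \<le> m\<close> by (cases m) auto
  have prefix: "\<exists>h'. pump a b m h = take b h @ h'" for h :: "'e list"
    unfolding pump_def m' take_loop[OF \<open>a \<le> b\<close>] by simp
  \<comment> \<open>If \<open>s\<close> lies past the end of \<open>h\<close>, the pumped list may
    still continue there; hence the cap at \<open>length h\<close>.\<close>
  have *: "take (min s (length h)) (pump a b m h) = take s h" for h :: "'e list"
  proof -
    obtain h' where "pump a b m h = take b h @ h'" using prefix by blast
    then show ?thesis using True by (cases "s \<le> length h") (auto simp: min_def)
  qed
  have "lag (pump a b m c) (pump a b m d) (min s (length c)) = lag c d s"
    using *[of c] *[of d] len by (simp add: lag_def)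
  then show ?thesis ..
next
  case False
  \<comment> \<open>The position to which \<open>b\<close> moves; it depends only on the length of
    the computation, so it is the same for \<open>d\<close>.\<close>
  define l where "l = length (take a c) + m * length (take (b - a) (drop a c))"
  have l: "take (l + (s - b)) (pump a b m h)
      = take a h @ word_pow m (take (b - a) (drop a h)) @ take (s - b) (drop b h)"
    if "length h = length c" for h :: "'e list"
  proof -
    have l': "l = length (take a h @ word_pow m (take (b - a) (drop a h)))"
      using that by (simp add: l_def)
    have "take (length xs + r) (xs @ ys) = xs @ take r ys" for xs ys :: "'e list" and r by simp
    from this[of "take a h @ word_pow m (take (b - a) (drop a h))" "s - b" "drop b h"]
    show ?thesis unfolding l' pump_def append.assoc .
  qed
  have s: "take s h = take a h @ take (b - a) (drop a h) @ take (s - b) (drop b h)" for h :: "'e list"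
    using False take_add[of b "s - b" h] by (simp add: take_loop[OF \<open>a \<le> b\<close>])
  have "lag (pump a b m c) (pump a b m d) (l + (s - b)) = lag c d s"
    unfolding lag_def l[OF refl] l[OF len[symmetric]] s[of c] s[of d] using same by simp
  then show ?thesis ..
qed

text \<open>Induction on the number of pairs with equal outputs. Each pumping separates at least one
  such pair and maintains the alternative of distinct outputs or a large lag; the common input
  changes on the way.\<close>

lemma separate_outputs:
  assumes "finite I" and L: "\<forall>e\<in>transitions T. length (word_out T e) \<le> L"
    and N: "L * card (states T) ^ card I \<le> N"
    and "\<And>i. i \<in> I \<Longrightarrow> c i \<in> successful T \<and> input_of T (c i) = u"
    and "\<And>i j. i \<in> I \<Longrightarrow> j \<in> I \<Longrightarrow> i \<noteq> j \<Longrightarrow>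
      output_of T (c i) \<noteq> output_of T (c j) \<or> (\<exists>s. int N < \<bar>lag (c i) (c j) s\<bar>)"
  shows "\<exists>c' u'. (\<forall>i\<in>I. c' i \<in> successful T \<and> input_of T (c' i) = u')
    \<and> inj_on (\<lambda>i. output_of T (c' i)) I"
  using assms(4,5)
proof (induction "card {(i, j) \<in> I \<times> I. i \<noteq> j \<and> output_of T (c i) = output_of T (c j)}"
    arbitrary: c u rule: less_induct)
  case less
  show ?case
  proof (cases "inj_on (\<lambda>i. output_of T (c i)) I")
    case True
    with less.prems(1) show ?thesis by blast
  next
    case False
    then obtain i j where ij: "i \<in> I" "j \<in> I" "i \<noteq> j" "output_of T (c i) = output_of T (c j)"
      by (auto simp: inj_on_def)
    with less.prems(2) obtain t where t: "int N < \<bar>lag (c i) (c j) t\<bar>" by blast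
    have path: "\<exists>q\<in>final T. is_path T (initial T) (c h) q" if "h \<in> I" for h
      using less.prems(1)[OF that] by (auto simp: successful_def)
    have "\<exists>r. is_path T (initial T) (take s (c h)) r" if "h \<in> I" for h s
      using path[OF that] path_take by blast
    then obtain st where st: "\<And>h s. h \<in> I \<Longrightarrow> is_path T (initial T) (take s (c h)) (st h s)"
      by metis
    \<comment> \<open>The state of the product after \<open>s\<close> steps, taken extensional so
      that there are at most \<open>card (states T) ^ card I\<close> of them.\<close>
    define \<sigma> where "\<sigma> s = (\<lambda>h\<in>I. st h s)" for s
    have trans: "set (c h) \<subseteq> transitions T" if "h \<in> I" for h
      using path[OF that] by (metis is_path_transitions)
    have "\<sigma> s \<in> I \<rightarrow>\<^sub>E states T" for s
      using is_path_target[OF st] by (auto simp: \<sigma>_def)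
    moreover have "card (I \<rightarrow>\<^sub>E states T) \<le> card (states T) ^ card I"
      using \<open>finite I\<close> by (simp add: card_PiE)
    moreover have "finite (I \<rightarrow>\<^sub>E states T)"
      using \<open>finite I\<close> finite_states by (intro finite_PiE)
    moreover have "int (L * card (states T) ^ card I) < \<bar>lag (c i) (c j) t\<bar>"
      using N t by linarith
    ultimately have "\<exists>a b. a < b \<and> \<sigma> a = \<sigma> b \<and> lag (c i) (c j) a \<noteq> lag (c i) (c j) b"
      by (intro exists_loop_with_drift[of "lag (c i) (c j)", OF lag_step[OF L trans trans] lag_0])
        (use ij in auto)
    then obtain a b where ab: "a < b" "\<sigma> a = \<sigma> b" "lag (c i) (c j) a \<noteq> lag (c i) (c j) b"
      by blast
    define x y z where "x h = output_of T (take a (c h))"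
      and "y h = output_of T (take (b - a) (drop a (c h)))"
      and "z h = output_of T (drop b (c h))" for h
    have out: "output_of T (c h) = x h @ y h @ z h" for h
      unfolding x_def y_def z_def
      using split_loop[of a b "c h"] ab(1) by (metis less_imp_le output_of_append)
    have out_pump: "output_of T (pump a b m (c h)) = x h @ word_pow m (y h) @ z h" for m h
      by (simp add: output_of_pump x_def y_def z_def)
    have drift: "length (y i) \<noteq> length (y j)"
      using ab(3) take_loop[of a b "c i"] take_loop[of a b "c j"] ab(1)
      by (auto simp: lag_def y_def)
    define P where "P = {(g, h) \<in> I \<times> I. output_of T (c g) \<noteq> output_of T (c h)}"
    have "finite P" unfolding P_def
      by (rule finite_subset[of _ "I \<times> I"]) (use \<open>finite I\<close> in auto)
    have "eventually (\<lambda>m. \<forall>(g, h)\<in>P. x g @ word_pow m (y g) @ z g \<noteq> x h @ word_pow m (y h) @ z h)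
      sequentially"
      by (rule eventually_ball_finite[OF \<open>finite P\<close>])
        (auto simp: P_def out intro!: eventually_pumped_neq)
    \<comment> \<open>With at least two copies the lengths before and after pumping give two
      independent equations, which \<open>len\<close> exploits.\<close>
    then obtain m where m: "2 \<le> m"
      and distinct: "\<And>g h. g \<in> I \<Longrightarrow> h \<in> I \<Longrightarrow> output_of T (c g) \<noteq> output_of T (c h) \<Longrightarrow>
        output_of T (pump a b m (c g)) \<noteq> output_of T (pump a b m (c h))"
      using eventually_happens[OF eventually_conj[OF _ eventually_ge_at_top[of 2]]]
      by (fastforce simp: P_def out_pump)
    \<comment> \<open>Subtracting the length equations before and after pumping leaves a positive
      multiple of the loop lengths. This shows both that the pair \<open>i\<close>, \<open>j\<close>
      is separated and that pairs still equal keep their lag.\<close>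
    have len: "length (y g) = length (y h)"
      if "output_of T (c g) = output_of T (c h)"
        "output_of T (pump a b m (c g)) = output_of T (pump a b m (c h))" for g h
    proof -
      obtain m' where m': "m = Suc (Suc m')" using m by (metis Suc_le_D numeral_2_eq_2 Suc_le_mono)
      have "length (x g) + length (y g) + length (z g) = length (x h) + length (y h) + length (z h)"
        using arg_cong[OF that(1), of length] by (simp add: out)
      moreover have "length (x g) + m * length (y g) + length (z g)
          = length (x h) + m * length (y h) + length (z h)"
        using arg_cong[OF that(2), of length] by (simp add: out_pump)
      ultimately have "Suc m' * length (y g) = Suc m' * length (y h)" by (simp add: m')
      then show ?thesis by (simp only: mult_cancel1) simp
    qed
    show ?thesis
    proof (rule less.hyps)
      let ?E = "\<lambda>c. {(i, j) \<in> I \<times> I. i \<noteq> j \<and> output_of T (c i) = output_of T (c j)}"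
      have "?E (\<lambda>h. pump a b m (c h)) \<subseteq> ?E c" using distinct by blast
      moreover have "(i, j) \<in> ?E c" using ij by simp
      moreover have "(i, j) \<notin> ?E (\<lambda>h. pump a b m (c h))" using len[OF ij(4)] drift by blast
      moreover have "finite (?E c)"
        by (rule finite_subset[of _ "I \<times> I"]) (use \<open>finite I\<close> in auto)
      ultimately show "card (?E (\<lambda>h. pump a b m (c h))) < card (?E c)"
        by (intro psubset_card_mono) blast+
    next
      fix h assume h: "h \<in> I"
      then obtain q where q: "q \<in> final T" "is_path T (initial T) (c h) q" using path by blast
      have "st h a = st h b" using fun_cong[OF ab(2), of h] h by (simp add: \<sigma>_def)
      with q(2) have "is_path T (initial T) (pump a b m (c h)) q"
        using st[OF h, of a] st[OF h, of b] ab(1) by (intro path_pump) auto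
      with q(1) show "pump a b m (c h) \<in> successful T
          \<and> input_of T (pump a b m (c h)) = pump a b m u"
        using less.prems(1)[OF h] by (auto simp: input_of_pump successful_def)
    next
      fix g h assume gh: "g \<in> I" "h \<in> I" "g \<noteq> h"
      show "output_of T (pump a b m (c g)) \<noteq> output_of T (pump a b m (c h))
          \<or> (\<exists>s. int N < \<bar>lag (pump a b m (c g)) (pump a b m (c h)) s\<bar>)"
      proof (unfold disj_imp, rule impI)
        assume "\<not> output_of T (pump a b m (c g)) \<noteq> output_of T (pump a b m (c h))"
        \<comment> \<open>Outputs equal after pumping were equal before, so the old large lag exists
          and survives by \<open>lag_pump\<close>.\<close>
        then have eq: "output_of T (pump a b m (c g)) = output_of T (pump a b m (c h))"
          "output_of T (c g) = output_of T (c h)" using distinct gh by auto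
        then obtain s where "int N < \<bar>lag (c g) (c h) s\<bar>" using less.prems(2) gh by blast
        moreover have "length (c g) = length (c h)"
          using less.prems(1) gh(1,2) by (metis input_of_def length_map)
        then obtain s' where "lag (pump a b m (c g)) (pump a b m (c h)) s' = lag (c g) (c h) s"
          using lag_pump[of "c g" "c h" a b m s] len[OF eq(2,1)] ab(1) m by (auto simp: y_def)
        ultimately show "\<exists>s. int N < \<bar>lag (pump a b m (c g)) (pump a b m (c h)) s\<bar>"
          by metis
      qed
    qed
  qed
qed

subsection \<open>Computations of the transducer with differences\<close>

text \<open>The second set in \<open>next_vec\<close> records the difference where the computations
  branch, and the first set carries it along; membership in \<open>Delta\<close> at every later
  moment keeps it from being cut off.\<close>

lemma difference_in_vec:
  fixes prec :: "'e \<Rightarrow> 'e \<Rightarrow> bool" and v :: "('q, 'b) vec"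
  defines "D \<equiv> \<lambda>c d. inv\<^bsub>free_group B\<^esub> (word (output_of T c)) \<otimes>\<^bsub>free_group B\<^esub> word (output_of T d)"
  assumes "is_path T p (pre @ e # c) q" "is_path T p (pre @ f # d) r"
    and "input_of T c = input_of T d" "letter_in T f = letter_in T e" "prec f e"
    and "\<And>s. length pre < s \<Longrightarrow> D (take s (pre @ e # c)) (take s (pre @ f # d)) \<in> Delta B N"
  shows "D (pre @ e # c) (pre @ f # d) \<in> foldl (next_vec B T prec N) v (pre @ e # c) r"
proof -
  interpret G: group "free_group B" by (rule group_free_group)
  have D_append: "D (c @ c') (d @ d') = inv\<^bsub>free_group B\<^esub> (word (output_of T c'))
      \<otimes>\<^bsub>free_group B\<^esub> D c d \<otimes>\<^bsub>free_group B\<^esub> word (output_of T d')"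
    if "output_of T c \<in> lists B" "output_of T d \<in> lists B"
      "output_of T c' \<in> lists B" "output_of T d' \<in> lists B" for c c' d d'
    using that[THEN word_closed]
    by (simp add: D_def word_append[of _ _ B] G.inv_mult_group G.m_assoc)
  show ?thesis
    using assms(2-4,7)
  proof (induction c arbitrary: d q r rule: rev_induct)
    case Nil
    then have d: "d = []" by (simp add: input_of_def)
    obtain p' where p': "is_path T p pre p'" "is_path T p' [e] q" "is_path T p' [f] r"
      using Nil(1,2) unfolding d path_append by (metis is_path_unique_target)
    \<comment> \<open>Up to the branching the outputs agree, so only the outputs of \<open>e\<close>
      and \<open>f\<close> contribute.\<close>
    have "D pre pre = \<one>\<^bsub>free_group B\<^esub>"
      using output_of_path[OF p'(1), THEN word_closed] by (simp add: D_def)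
    then have "D (pre @ [e]) (pre @ [f])
        = inv\<^bsub>free_group B\<^esub> (word (word_out T e)) \<otimes>\<^bsub>free_group B\<^esub> word (word_out T f)"
      using D_append[of pre pre "[e]" "[f]"] output_of_path[OF p'(1)] p'(2,3)
      by (simp add: output_of_Cons word_out_alphabet word_closed del: in_lists_conv_set)
    moreover have "D (pre @ [e]) (pre @ [f]) \<in> Delta B N"
      using Nil(4)[of "Suc (length pre)"] d by simp
    ultimately show ?case
      unfolding d using p'(2,3) assms(5,6) by (auto simp: next_vec_def)
  next
    case (snoc e' c)
    obtain f' d' where d: "d = d' @ [f']"
      using snoc.prems(3) by (cases d rule: rev_cases) (auto simp: input_of_def)
    have inp: "input_of T c = input_of T d'" "letter_in T f' = letter_in T e'"
      using snoc.prems(3) by (auto simp: d input_of_def)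
    have "length c = length d'" using inp(1) by (metis input_of_def length_map)
    obtain q' r' where path: "is_path T p (pre @ e # c) q'" "is_path T q' [e'] q"
        "is_path T p (pre @ f # d') r'" "is_path T r' [f'] r"
      using snoc.prems(1,2) path_append[of p "pre @ e # c" "[e']" q]
        path_append[of p "pre @ f # d'" "[f']" r] by (auto simp: d)
    have "D (take s (pre @ e # c)) (take s (pre @ f # d')) \<in> Delta B N" if "length pre < s" for s
    proof -
      \<comment> \<open>The shorter computations end one transition earlier; moments past their end
        are moved back to it, so that the last transitions are not included.\<close>
      define s' where "s' = min s (length (pre @ e # c))"
      have "take s (pre @ e # c) = take s' (pre @ e # c @ [e'])"
        "take s (pre @ f # d') = take s' (pre @ f # d' @ [f'])"
        using \<open>length c = length d'\<close> that unfolding s'_def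
        by (auto simp: min_def take_Cons' not_le)
      moreover have "length pre < s'" using that by (simp add: s'_def)
      ultimately show ?thesis using snoc.prems(4)[of s'] by (simp add: d)
    qed
    from snoc.IH[OF path(1,3) inp(1) this]
    have IH: "D (pre @ e # c) (pre @ f # d') \<in> foldl (next_vec B T prec N) v (pre @ e # c) r'" .
    have "D (pre @ e # c @ [e']) (pre @ f # d) = inv\<^bsub>free_group B\<^esub> (word (word_out T e'))
        \<otimes>\<^bsub>free_group B\<^esub> D (pre @ e # c) (pre @ f # d') \<otimes>\<^bsub>free_group B\<^esub> word (word_out T f')"
      using D_append[of "pre @ e # c" "pre @ f # d'" "[e']" "[f']"]
        path[THEN output_of_path] by (simp add: d output_of_Cons del: in_lists_conv_set)
    moreover have "D (pre @ e # c @ [e']) (pre @ f # d) \<in> Delta B N"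
      using snoc.prems(4)[of "length (pre @ e # c @ [e'])"] \<open>length c = length d'\<close> by (simp add: d)
    moreover have "f' \<in> transitions T" "origin T f' = r'" "target T f' = r" "r \<in> states T"
      using path(4) by auto
    ultimately have "D (pre @ e # c @ [e']) (pre @ f # d)
        \<in> next_vec B T prec N (foldl (next_vec B T prec N) v (pre @ e # c)) e' r"
      using IH inp(2) unfolding next_vec_def by auto
    then show ?case by simp
  qed
qed

text \<open>Two prefixes of one word are comparable, so their difference is the excess word or its
  inverse.\<close>

lemma difference_in_Delta:
  assumes "x \<in> lists B" "y \<in> lists B" and eq: "x @ x' = y @ y'"
    and len: "\<bar>int (length x) - int (length y)\<bar> \<le> int N"
  shows "inv\<^bsub>free_group B\<^esub> (word x) \<otimes>\<^bsub>free_group B\<^esub> word y \<in> Delta B N"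
proof -
  interpret G: group "free_group B" by (rule group_free_group)
  from eq consider w where "y = x @ w" | w where "x = y @ w"
    by (auto simp: append_eq_append_conv2)
  then show ?thesis
  proof cases
    case 1
    then have w: "w \<in> lists B" "length w \<le> N" using assms by auto
    then have "inv\<^bsub>free_group B\<^esub> (word x) \<otimes>\<^bsub>free_group B\<^esub> word y = word w"
      using assms(1)[THEN word_closed] w(1)[THEN word_closed] 1
      by (simp add: word_append[of _ _ B] G.m_assoc[symmetric])
    with w show ?thesis unfolding Delta_def by blast
  next
    case 2
    then have w: "w \<in> lists B" "length w \<le> N" using assms by auto
    then have "inv\<^bsub>free_group B\<^esub> (word x) \<otimes>\<^bsub>free_group B\<^esub> word y = inv\<^bsub>free_group B\<^esub> (word w)"
      using assms(2)[THEN word_closed] w(1)[THEN word_closed] 2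
      by (simp add: word_append[of _ _ B] G.inv_mult_group G.m_assoc)
    with w show ?thesis unfolding Delta_def by blast
  qed
qed

section \<open>Projecting computations of \<open>V_trans\<close> to \<open>T\<close>\<close>

lemma path_V_project:
  assumes "is_path (V_trans B T prec N) (p, v) c q"
  shows "is_path T p (map snd c) (fst q)
    \<and> snd q = foldl (next_vec B T prec N) v (map snd c)"
  using assms
proof (induction c arbitrary: p v)
  case (Cons a c)
  obtain p' v' e where a: "a = ((p', v'), e)" by (metis prod.exhaust)
  with Cons.prems have eq: "p' = p" "v' = v" and e: "e \<in> transitions T" "origin T e = p"
    by (auto simp: V_trans_def U_trans_def)
  with Cons.prems have "is_path (V_trans B T prec N) (target T e, next_vec B T prec N v e) c q"
    by (simp add: a V_trans_def U_trans_def)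
  with Cons.IH e show ?case by (simp add: a)
qed (auto simp: V_trans_def U_trans_def)

text \<open>A transition is a source state paired with a transition of \<open>T\<close>, and the
  source is fixed by the path so far. Hence counting computations loses nothing under
  projection.\<close>

lemma path_V_inj:
  assumes "is_path (V_trans B T prec N) s c q" "is_path (V_trans B T prec N) s d r"
    and "map snd c = map snd d"
  shows "c = d"
  using assms
proof (induction c arbitrary: s d)
  case (Cons e c)
  then obtain e' d' where "d = e' # d'" by (cases d) auto
  with Cons show ?case by (auto simp: V_trans_def U_trans_def)
qed simp

lemma input_of_V: "input_of (V_trans B T prec N) c = input_of T (map snd c)"
  by (auto simp: input_of_def V_trans_def U_trans_def)

lemma successful_V:
  assumes "c \<in> successful (V_trans B T prec N)"
  obtains t where "t \<in> final T" "is_path T (initial T) (map snd c) t"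
    "\<And>t'. t' \<in> final T \<Longrightarrow> \<one>\<^bsub>free_group B\<^esub>
       \<notin> foldl (next_vec B T prec N) (\<lambda>r\<in>states T. {}) (map snd c) t'"
proof -
  obtain q where q: "q \<in> final (V_trans B T prec N)"
    "is_path (V_trans B T prec N) (initial T, \<lambda>r\<in>states T. {}) c q"
    using assms by (auto simp: successful_def V_trans_def U_trans_def)
  with path_V_project[OF q(2)] show ?thesis
    by (intro that[of "fst q"]) (auto simp: V_trans_def U_trans_def)
qed

text \<open>Were all lags at most \<open>N\<close>, the vector reached by \<open>c\<close> would
  record the total difference from \<open>d\<close>. As the outputs are equal this is the identity,
  at a final state of \<open>T\<close>, so \<open>c\<close> would not be successful.\<close>

lemma smaller_computation_lag:
  assumes c: "c \<in> successful (V_trans B T prec N)" and d: "d \<in> successful (V_trans B T prec N)"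
    and c_eq: "map snd c = pre @ e # c'" and d_eq: "map snd d = pre @ f # d'"
    and inp: "input_of T (map snd c) = input_of T (map snd d)"
    and "prec f e" and out: "output_of T (map snd c) = output_of T (map snd d)"
  shows "\<exists>s. int N < \<bar>lag (map snd c) (map snd d) s\<bar>"
proof (rule ccontr)
  assume "\<not> ?thesis"
  then have lag: "\<bar>lag (map snd c) (map snd d) s\<bar> \<le> int N" for s by (simp add: not_less)
  obtain q where q: "is_path T (initial T) (map snd c) q"
    and no: "\<And>t'. t' \<in> final T \<Longrightarrow> \<one>\<^bsub>free_group B\<^esub>
       \<notin> foldl (next_vec B T prec N) (\<lambda>r\<in>states T. {}) (map snd c) t'"
    using successful_V[OF c] by metis
  obtain r where r: "r \<in> final T" "is_path T (initial T) (map snd d) r"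
    using successful_V[OF d] by metis
  interpret G: group "free_group B" by (rule group_free_group)
  have "inv\<^bsub>free_group B\<^esub> (word (output_of T (take s (map snd c))))
      \<otimes>\<^bsub>free_group B\<^esub> word (output_of T (take s (map snd d))) \<in> Delta B N" for s
  proof (rule difference_in_Delta)
    show "output_of T (take s (map snd c)) \<in> lists B" "output_of T (take s (map snd d)) \<in> lists B"
      using path_take[OF q] path_take[OF r(2)] output_of_path by blast+
    show "output_of T (take s (map snd c)) @ output_of T (drop s (map snd c))
        = output_of T (take s (map snd d)) @ output_of T (drop s (map snd d))"
      using out by (metis append_take_drop_id output_of_append)
  qed (use lag[of s] in \<open>simp add: lag_def\<close>)
  note Delta = this
  have "inv\<^bsub>free_group B\<^esub> (word (output_of T (map snd c)))
      \<otimes>\<^bsub>free_group B\<^esub> word (output_of T (map snd d))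
      \<in> foldl (next_vec B T prec N) (\<lambda>r\<in>states T. {}) (map snd c) r"
    unfolding c_eq d_eq
  proof (rule difference_in_vec)
    show "input_of T c' = input_of T d'" "letter_in T f = letter_in T e"
      using inp by (simp_all add: c_eq d_eq input_of_def)
  qed (use q r(2) Delta \<open>prec f e\<close> in \<open>simp_all only: c_eq d_eq\<close>)
  then show False
    using no[OF r(1)] output_of_path[OF r(2), THEN word_closed] by (simp add: out)
qed

lemma distinct_computations_lag:
  assumes ord: "transition_order T prec"
    and c: "c \<in> successful (V_trans B T prec N)" and d: "d \<in> successful (V_trans B T prec N)"
    and "c \<noteq> d" and inp: "input_of T (map snd c) = input_of T (map snd d)"
    and out: "output_of T (map snd c) = output_of T (map snd d)"
  shows "\<exists>s. int N < \<bar>lag (map snd c) (map snd d) s\<bar>"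
proof -
  have "map snd c \<noteq> map snd d"
    using c d \<open>c \<noteq> d\<close> path_V_inj unfolding successful_def by blast
  moreover have "length (map snd c) = length (map snd d)"
    using inp by (metis input_of_def length_map)
  ultimately obtain pre e c' f d'
    where *: "e \<noteq> f" "map snd c = pre @ e # c'" "map snd d = pre @ f # d'"
    using same_length_different by (metis append_Cons append_Nil)
  obtain q r where path: "is_path T (initial T) (map snd c) q" "is_path T (initial T) (map snd d) r"
    using successful_V[OF c] successful_V[OF d] by metis
  \<comment> \<open>The common prefix has only one target, so at the first disagreement the
    transitions are comparable; the order decides which computation is the larger one.\<close>
  then have "e \<in> transitions T" "f \<in> transitions T" "origin T e = origin T f"
    unfolding * path_append using is_path_unique_target by fastforce+
  moreover have "letter_in T e = letter_in T f"
    using inp by (simp add: * input_of_def)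
  ultimately have "prec e f \<or> prec f e"
    using ord \<open>e \<noteq> f\<close> unfolding transition_order_def by blast
  then show ?thesis
  proof
    assume "prec f e"
    then show ?thesis using smaller_computation_lag[OF c d *(2,3) inp _ out] by blast
  next
    assume "prec e f"
    then obtain s where "int N < \<bar>lag (map snd d) (map snd c) s\<bar>"
      using smaller_computation_lag[OF d c *(3,2) inp[symmetric] _ out[symmetric]] by blast
    then show ?thesis by (auto simp: lag_def abs_minus_commute)
  qed
qed

end

theorem proposition4p2:
  fixes A :: "'a set" and B :: "'b set"
    and T :: "('q, 'a, 'b, 'e) transducer"
    and prec :: "'e \<Rightarrow> 'e \<Rightarrow> bool"
    and k L n N :: nat
  assumes "real_time_transducer A B T"
    and "transition_order T prec"
    and "card (states T) = n"
    and "\<forall>e\<in>transitions T. length (word_out T e) \<le> L"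
    and "valued k A T"
    and "N \<ge> L * n ^ (k + 1)"
  shows "input_ambiguous k A (V_trans B T prec N)"
proof -
  interpret real_time_transducer A B T by fact
  have False
    if J: "J = {c \<in> successful (V_trans B T prec N). input_of (V_trans B T prec N) c = u}"
      and large: "\<not> (finite J \<and> card J \<le> k)" for J u
  proof -
    \<comment> \<open>Exactly \<open>k + 1\<close> computations are selected, even if there are
      infinitely many, to match the exponent in the bound on \<open>N\<close>.\<close>
    obtain I where I: "I \<subseteq> J" "finite I" "card I = k + 1"
      using large infinite_arbitrarily_large[of J "k + 1"] obtain_subset_with_card_n[of "k + 1" J]
      by (metis Suc_eq_plus1 not_less_eq_eq)
    have I_V: "c \<in> successful (V_trans B T prec N)" "input_of T (map snd c) = u" if "c \<in> I" for c
      using that I(1) by (auto simp: J input_of_V)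
    have "\<exists>c' u'. (\<forall>i\<in>I. c' i \<in> successful T \<and> input_of T (c' i) = u')
        \<and> inj_on (\<lambda>i. output_of T (c' i)) I"
    proof (rule separate_outputs[OF I(2) assms(4)])
      show "L * card (states T) ^ card I \<le> N" using assms(3,6) I(3) by simp
    next
      fix i assume "i \<in> I"
      then show "map snd i \<in> successful T \<and> input_of T (map snd i) = u"
        using successful_V[OF I_V(1)] I_V(2) unfolding successful_def by blast
    next
      fix i j assume "i \<in> I" "j \<in> I" "i \<noteq> j"
      then show "output_of T (map snd i) \<noteq> output_of T (map snd j)
          \<or> (\<exists>s. int N < \<bar>lag (map snd i) (map snd j) s\<bar>)"
        using distinct_computations_lag[OF assms(2)] I_V by metis
    qed
    then obtain c' u' where c': "\<And>i. i \<in> I \<Longrightarrow> c' i \<in> successful T \<and> input_of T (c' i) = u'"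
      and inj: "inj_on (\<lambda>i. output_of T (c' i)) I" by blast
    let ?O = "output_of T ` {c \<in> successful T. input_of T c = u'}"
    \<comment> \<open>Some computation reads \<open>u'\<close>, so \<open>u'\<close> is a word over
      \<open>A\<close> and \<open>k\<close>-valuedness applies to it.\<close>
    have "I \<noteq> {}" using I(3) by auto
    then have "u' \<in> lists A" using c' input_of_successful by blast
    then have "finite ?O" "card ?O \<le> k" using assms(5) unfolding valued_def by blast+
    moreover have "(\<lambda>i. output_of T (c' i)) ` I \<subseteq> ?O" using c' by blast
    ultimately have "card I \<le> k" using card_inj_on_le[OF inj] le_trans by blast
    with I(3) show False by simp
  qed
  then show ?thesis unfolding input_ambiguous_def by blast
qed

end
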